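(* Let $\alpha$ be an irrational point of $\mathbb{R}/\mathbb{Z}$ and let $\beta\in\mathbb{Q}/\mathbb{Z}$. Then $\chi_\beta(\alpha)=1$ if and only if $\beta\in E_n(\alpha)$ for some $n\ge1$. Moreover, for every positive integer $Q$, $$\sum_{h(\beta)\le Q}\chi_\beta(\alpha)=\sum_{q=1}^QX_q(\alpha),$$ and this sum equals the number of elements of $\bigcup_{n\ge1}E_n(\alpha)$ of height at most $Q$, i.e. the number of convergents and intermediate convergents of $\alpha$ with height at most $Q$.
   Context: Every $\beta\in\mathbb{Q}/\mathbb{Z}$ can be written $\beta=a/q$ with $q\ge1$ and $\gcd(a,q)=1$; its height is $h(\beta)=q$. Put $\mathcal{F}_Q=\{\beta:h(\beta)\le Q\}$. For distinct $a,b\in\mathbb{R}/\mathbb{Z}$, $I(a,b)$ is the open arc from $a$ to $b$ in the positive direction, i.e. $\{a+t\bmod 1:0<t<d\}$ with $d\in(0,1)$, $d\equiv b-a$. $\overline{I}(a,b)$ is its closure. For $\beta\ne0$ with $h(\beta)=Q$: $\beta'$ is the unique point of $\mathcal{F}_Q$ with $I(\beta',\beta)\cap\mathcal{F}_Q=\emptyset$, and $\beta''$ is the unique point of $\mathcal{F}_Q$ with $I(\beta,\beta'')\cap\mathcal{F}_Q=\emptyset$. Define $\chi_0\equiv1$. For $\beta\ne0$ let $\chi_\beta(x)=1$ for $x\in I(\beta',\beta'')$, $\chi_\beta(x)=\tfrac12$ for $x\in\{\beta',\beta''\}$, and $\chi_\beta(x)=0$ for $x\notin\overline{I}(\beta',\beta'')$.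 Put $X_q(x)=\sum_{h(\beta)=q}\chi_\beta(x)$. Identify an irrational $\alpha$ with its representative in $(0,1)$ and write $\alpha=[0;a_1,a_2,\dots]$. Set $p_{-2}=0$, $q_{-2}=1$, $p_{-1}=1$, $q_{-1}=0$, and for $n\ge0$ set $p_n=a_np_{n-1}+p_{n-2}$ and $q_n=a_nq_{n-1}+q_{n-2}$, with $a_0=0$. For $n\ge1$, $E_n(\alpha)=\{(mp_{n-1}+p_{n-2})/(mq_{n-1}+q_{n-2}):1\le m\le a_n\}\subset\mathbb{Q}/\mathbb{Z}$.
   Formalization: For β=1/2 both neighbours β', β'' equal 0, so I(β',β'') is undefined as stated (I(a,b) needs a≠b); here I(a,a) is taken to be the circle without a, so that χ_{1/2} is 1 off 0 and 1/2 at 0. *)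

theory Defs
  imports "HOL-Analysis.Analysis"
begin

section \<open>The circle \<open>\<real>/\<int>\<close>\<close>

quotient_type circle = real / "\<lambda>x y. x - y \<in> \<int>"
  morphisms rep_circle to_circle
proof (rule equivpI)
  show "reflp (\<lambda>x y::real. x - y \<in> \<int>)"
    by (auto simp: reflp_def)
  show "symp (\<lambda>x y::real. x - y \<in> \<int>)"
    by (auto simp: symp_def intro: Ints_minus[of "_ - _", simplified])
  show "transp (\<lambda>x y::real. x - y \<in> \<int>)"
  proof (rule transpI)
    fix x y z :: real
    assume "x - y \<in> \<int>" "y - z \<in> \<int>"
    then have "(x - y) + (y - z) \<in> \<int>" by (rule Ints_add)
    then show "x - z \<in> \<int>" by simp
  qed
qed

lemma to_circle_eq_iff: "to_circle x = to_circle y \<longleftrightarrow> x - y \<in> \<int>"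
  by (simp add: circle.abs_eq_iff)

lemma circle_cases: obtains x where "c = to_circle x"
  by (metis Quotient3_abs_rep Quotient3_circle)

instantiation circle :: ab_group_add
begin

lift_definition zero_circle :: circle is 0 .

lift_definition plus_circle :: "circle \<Rightarrow> circle \<Rightarrow> circle" is "(+)"
  by (metis Ints_add add_diff_add)

lift_definition uminus_circle :: "circle \<Rightarrow> circle" is uminus
  by (metis Ints_minus minus_diff_minus)

lift_definition minus_circle :: "circle \<Rightarrow> circle \<Rightarrow> circle" is "(-)"
  by (metis Ints_diff diff_diff_eq2 diff_add_eq diff_diff_add add.commute add_diff_eq)

instance
  by standard (transfer; simp)+

end

lemma to_circle_0: "to_circle 0 = 0"
  by (simp add: zero_circle_def)

lemma to_circle_add: "to_circle (x + y) = to_circle x + to_circle y"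
  by (simp add: plus_circle.abs_eq)

lemma to_circle_diff: "to_circle (x - y) = to_circle x - to_circle y"
  by (simp add: minus_circle.abs_eq)

instantiation circle :: topological_space
begin

definition open_circle :: "circle set \<Rightarrow> bool" where
  "open_circle U \<longleftrightarrow> open (to_circle -` U)"

instance
  by standard (auto simp: open_circle_def vimage_Union)

end

text \<open>
  For \<open>a \<noteq> b\<close> the number \<open>d\<close> is automatically less than \<open>1\<close>. Admitting \<open>d = 1\<close> makes
  \<open>open_arc a a\<close> the circle without \<open>a\<close>; this is needed for \<open>\<beta> = 1/2\<close>, whose two
  neighbours in the Farey set of order \<open>2\<close> both equal \<open>0\<close>.
\<close>

definition open_arc :: "circle \<Rightarrow> circle \<Rightarrow> circle set" where
  "open_arc a b =
    {a + to_circle t | t. \<exists>d. 0 < d \<and> d \<le> 1 \<and> to_circle d = b - a \<and> 0 < t \<and> t < d}"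

definition closed_arc :: "circle \<Rightarrow> circle \<Rightarrow> circle set" where
  "closed_arc a b = closure (open_arc a b)"


section \<open>Heights and Farey sets\<close>

definition QZ :: "circle set" where
  "QZ = to_circle ` \<rat>"

definition height :: "circle \<Rightarrow> nat" where
  "height \<beta> = (THE q. q \<ge> 1 \<and>
     (\<exists>a::int. coprime a (int q) \<and> \<beta> = to_circle (of_int a / of_nat q)))"

definition farey :: "nat \<Rightarrow> circle set" where
  "farey Q = {\<beta> \<in> QZ. height \<beta> \<le> Q}"

definition left_nb :: "circle \<Rightarrow> circle" where
  "left_nb \<beta> = (THE \<gamma>. \<gamma> \<in> farey (height \<beta>) \<and> \<gamma> \<noteq> \<beta> \<and>
     open_arc \<gamma> \<beta> \<inter> farey (height \<beta>) = {})"

definition right_nb :: "circle \<Rightarrow> circle" where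
  "right_nb \<beta> = (THE \<gamma>. \<gamma> \<in> farey (height \<beta>) \<and> \<gamma> \<noteq> \<beta> \<and>
     open_arc \<beta> \<gamma> \<inter> farey (height \<beta>) = {})"

definition chi :: "circle \<Rightarrow> circle \<Rightarrow> real" where
  "chi \<beta> x =
    (if \<beta> = 0 then 1
     else if x \<in> open_arc (left_nb \<beta>) (right_nb \<beta>) then 1
     else if x \<in> {left_nb \<beta>, right_nb \<beta>} then 1/2
     else 0)"

definition X :: "nat \<Rightarrow> circle \<Rightarrow> real" where
  "X q x = (\<Sum>\<beta> | \<beta> \<in> QZ \<and> height \<beta> = q. chi \<beta> x)"


section \<open>Continued fractions\<close>

definition unit_rep :: "circle \<Rightarrow> real" where
  "unit_rep \<alpha> = (THE r. 0 \<le> r \<and> r < 1 \<and> to_circle r = \<alpha>)"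

primrec cf_rem :: "real \<Rightarrow> nat \<Rightarrow> real" where
  "cf_rem x 0 = x"
| "cf_rem x (Suc n) = 1 / frac (cf_rem x n)"

definition cf_quot :: "real \<Rightarrow> nat \<Rightarrow> int" where
  "cf_quot x n = \<lfloor>cf_rem x n\<rfloor>"

text \<open>
  The indices are shifted by two: \<open>cf_p x n\<close> and \<open>cf_q x n\<close> are the usual \<open>p\<^sub>n\<^sub>-\<^sub>2\<close> and
  \<open>q\<^sub>n\<^sub>-\<^sub>2\<close>.
\<close>

fun cf_p :: "real \<Rightarrow> nat \<Rightarrow> int" where
  "cf_p x 0 = 0"
| "cf_p x (Suc 0) = 1"
| "cf_p x (Suc (Suc n)) = cf_quot x n * cf_p x (Suc n) + cf_p x n"

fun cf_q :: "real \<Rightarrow> nat \<Rightarrow> int" where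
  "cf_q x 0 = 1"
| "cf_q x (Suc 0) = 0"
| "cf_q x (Suc (Suc n)) = cf_quot x n * cf_q x (Suc n) + cf_q x n"

definition E :: "nat \<Rightarrow> circle \<Rightarrow> circle set" where
  "E n \<alpha> = (let x = unit_rep \<alpha> in
    {to_circle (of_int (m * cf_p x (n + 1) + cf_p x n) / of_int (m * cf_q x (n + 1) + cf_q x n))
      | m. 1 \<le> m \<and> m \<le> cf_quot x n})"


section \<open>Well-definedness\<close>

lemma unit_rep_ex1: "\<exists>!r. 0 \<le> r \<and> r < 1 \<and> to_circle r = \<alpha>"
proof -
  obtain x where x: "\<alpha> = to_circle x" by (rule circle_cases)
  show ?thesis
  proof (rule ex1I[of _ "frac x"])
    show "0 \<le> frac x \<and> frac x < 1 \<and> to_circle (frac x) = \<alpha>"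
      using frac_lt_1[of x] frac_ge_0[of x] by (auto simp: x to_circle_eq_iff frac_def)
    fix r assume r: "0 \<le> r \<and> r < 1 \<and> to_circle r = \<alpha>"
    then have "x - r \<in> \<int>" unfolding x by (metis to_circle_eq_iff)
    with r show "r = frac x" by (metis frac_unique_iff)
  qed
qed

lemma height_eqI:
  assumes "coprime a (int q)" "q \<ge> 1"
  shows "height (to_circle (of_int a / of_nat q)) = q"
  unfolding height_def
proof (rule the_equality)
  show "1 \<le> q \<and> (\<exists>aa. coprime aa (int q) \<and>
      to_circle (of_int a / of_nat q) = to_circle (of_int aa / of_nat q))"
    using assms by blast
next
  fix r assume "1 \<le> r \<and> (\<exists>b. coprime b (int r) \<and>
      to_circle (of_int a / of_nat q) = to_circle (of_int b / of_nat r))"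
  then obtain b where b: "1 \<le> r" "coprime b (int r)"
      "of_int a / of_nat q - of_int b / of_nat r \<in> (\<int> :: real set)"
    by (auto simp: to_circle_eq_iff)
  then obtain k :: int where "of_int a / of_nat q - of_int b / of_nat r = (of_int k :: real)"
    by (auto elim: Ints_cases)
  then have "(of_int (a * int r - b * int q) :: real) = of_int (k * int q * int r)"
    using b(1) assms(2) by (simp add: field_simps)
  then have eq: "a * int r - b * int q = k * int q * int r"
    by (simp only: of_int_eq_iff)
  then have 1: "a * int r = int q * (b + k * int r)" and 2: "b * int q = int r * (a - k * int q)"
    by (auto simp: algebra_simps)
  have "int q dvd a * int r" unfolding 1 by simp
  then have "int q dvd int r"
    using assms(1) by (simp add: coprime_commute coprime_dvd_mult_right_iff)
  moreover have "int r dvd b * int q" unfolding 2 by simp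
  then have "int r dvd int q"
    using b(2) by (simp add: coprime_commute coprime_dvd_mult_right_iff)
  ultimately show "r = q" by (simp add: dvd_antisym)
qed

lemma QZ_cases:
  assumes "\<beta> \<in> QZ"
  obtains a q where "q \<ge> 1" "coprime a (int q)" "\<beta> = to_circle (of_int a / of_nat q)" "height \<beta> = q"
proof -
  obtain x where x: "x \<in> \<rat>" "\<beta> = to_circle x" using assms by (auto simp: QZ_def)
  from x(1) obtain a b where ab: "b > 0" "coprime a b" "x = of_int a / of_int b"
    by (rule Rats_cases')
  show ?thesis
    by (rule that[of "nat b" a]) (use ab x height_eqI[of a "nat b"] in auto)
qed

lemma finite_farey: "finite (farey Q)"
proof (rule finite_subset)
  show "farey Q \<subseteq> (\<lambda>(a, q). to_circle (of_int a / of_nat q)) ` ({0..int Q} \<times> {1..Q})"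
  proof
    fix \<beta> assume \<beta>: "\<beta> \<in> farey Q"
    then obtain a q where aq: "q \<ge> 1" "\<beta> = to_circle (of_int a / of_nat q)" "q \<le> Q"
      by (auto simp: farey_def elim: QZ_cases)
    have "(of_int a :: real) = of_int (int q * (a div int q) + a mod int q)"
      by simp
    also have "\<dots> = of_nat q * of_int (a div int q) + of_int (a mod int q)"
      by (simp only: of_int_add of_int_mult of_int_of_nat_eq)
    finally have "of_int a / of_nat q - of_int (a mod int q) / of_nat q
        = (of_int (a div int q) :: real)"
      using aq(1) by (simp add: field_simps)
    then have "\<beta> = to_circle (of_int (a mod int q) / of_nat q)"
      unfolding aq(2) to_circle_eq_iff by (metis Ints_of_int)
    moreover have "a mod int q \<in> {0..int Q}"
      using pos_mod_bound[of "int q" a] pos_mod_sign[of "int q" a] aq(1,3)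
      unfolding atLeastAtMost_iff by linarith
    ultimately show "\<beta> \<in> (\<lambda>(a, q). to_circle (of_int a / of_nat q)) ` ({0..int Q} \<times> {1..Q})"
      using aq(1,3) by (intro image_eqI[of _ _ "(a mod int q, q)"]) auto
  qed
qed auto

lemma fwd_ex1: "\<exists>!d. 0 < d \<and> d \<le> 1 \<and> to_circle d = c"
proof -
  obtain r where r: "0 \<le> r" "r < 1" "to_circle r = - c" using unit_rep_ex1 by blast
  have "to_circle (1 - r) = c"
  proof -
    have "to_circle 1 = 0" by (simp add: to_circle_eq_iff flip: to_circle_0)
    then show ?thesis by (simp add: to_circle_diff r)
  qed
  moreover have "d = e" if "0 < d" "d \<le> 1" "to_circle d = c" "0 < e" "e \<le> 1" "to_circle e = c" for d e
  proof -
    have "d - e \<in> \<int>" using that by (simp flip: to_circle_eq_iff)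
    then obtain k :: int where k: "d - e = of_int k" by (auto elim: Ints_cases)
    then have "k = 0" using that by linarith
    then show ?thesis using k by simp
  qed
  ultimately show ?thesis using r by (intro ex1I[of _ "1 - r"]) auto
qed

lemma open_arc_image:
  assumes "0 < d" "d \<le> 1"
  shows "open_arc (to_circle u) (to_circle (u + d)) = to_circle ` {u<..<u + d}"
proof -
  have eq: "e = d" if "0 < e" "e \<le> 1" "to_circle e = to_circle d" for e
    using fwd_ex1[of "to_circle d"] that assms by blast
  show ?thesis
  proof (intro set_eqI iffI)
    fix x assume "x \<in> open_arc (to_circle u) (to_circle (u + d))"
    then obtain t e where te: "x = to_circle (u + t)" "0 < e" "e \<le> 1" "to_circle e = to_circle d"
        "0 < t" "t < e"
      by (auto simp: open_arc_def to_circle_add)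
    then have "e = d" by (intro eq)
    with te show "x \<in> to_circle ` {u<..<u + d}" by auto
  next
    fix x assume "x \<in> to_circle ` {u<..<u + d}"
    then obtain y where y: "x = to_circle y" "u < y" "y < u + d" by auto
    then have "x = to_circle u + to_circle (y - u)" by (simp add: to_circle_diff)
    moreover have "to_circle d = to_circle (u + d) - to_circle u" by (simp add: to_circle_add)
    ultimately show "x \<in> open_arc (to_circle u) (to_circle (u + d))"
      unfolding open_arc_def using assms y(2,3)
      by (intro CollectI exI[of _ "y - u"] exI[of _ d] conjI) auto
  qed
qed

lemma closed_arc_eq: "closed_arc a b = open_arc a b \<union> {a, b}"
proof -
  obtain u where u: "a = to_circle u" by (rule circle_cases)
  obtain d where d: "0 < d" "d \<le> 1" "to_circle d = b - a" using fwd_ex1 by blast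
  have b: "b = to_circle (u + d)" by (simp add: to_circle_add d u)
  have cont: "continuous_on UNIV to_circle"
    by (simp add: continuous_on_open_vimage open_circle_def)
  have mem: "to_circle x \<in> to_circle ` {u..u + d} \<longleftrightarrow> frac (x - u) \<le> d" for x
  proof
    assume "to_circle x \<in> to_circle ` {u..u + d}"
    then obtain y where y: "x - y \<in> \<int>" "u \<le> y" "y \<le> u + d"
      by (auto simp: to_circle_eq_iff)
    show "frac (x - u) \<le> d"
    proof (cases "y - u < 1")
      case True
      then have "frac (x - u) = y - u" using y by (subst frac_unique_iff) auto
      then show ?thesis using y by simp
    next
      case False
      then show ?thesis using y d frac_lt_1[of "x - u"] by linarith
    qed
  next
    assume "frac (x - u) \<le> d"
    moreover have "to_circle x = to_circle (u + frac (x - u))"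
      by (simp add: to_circle_eq_iff frac_def)
    ultimately show "to_circle x \<in> to_circle ` {u..u + d}" by auto
  qed
  have "to_circle -` (- to_circle ` {u..u + d}) = (\<Union>k::int. {u + of_int k + d<..<u + of_int k + 1})"
    (is "?L = ?R")
  proof (intro set_eqI iffI)
    fix x assume "x \<in> ?L"
    then have "d < frac (x - u)" by (simp add: mem)
    then have "x \<in> {u + of_int \<lfloor>x - u\<rfloor> + d<..<u + of_int \<lfloor>x - u\<rfloor> + 1}"
      unfolding frac_def by (simp, linarith)
    then show "x \<in> ?R" by blast
  next
    fix x assume "x \<in> ?R"
    then obtain k :: int where k: "u + of_int k + d < x" "x < u + of_int k + 1" by auto
    then have "\<lfloor>x - u\<rfloor> = k" using d by linarith
    then show "x \<in> ?L" using k by (simp add: mem frac_def)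
  qed
  then have "closed (to_circle ` {u..u + d})"
    unfolding closed_def open_circle_def by (simp only:) (intro open_UN ballI open_greaterThanLessThan)
  then have "closure (to_circle ` {u<..<u + d}) \<subseteq> to_circle ` {u..u + d}"
    by (intro closure_minimal image_mono) auto
  moreover have "to_circle ` closure {u<..<u + d} \<subseteq> closure (to_circle ` {u<..<u + d})"
    by (intro image_closure_subset continuous_on_subset[OF cont]) (auto simp: closure_subset)
  ultimately have "closure (to_circle ` {u<..<u + d}) = to_circle ` {u..u + d}"
    using d by auto
  also have "{u..u + d} = {u<..<u + d} \<union> {u, u + d}" using d by auto
  finally show ?thesis
    using open_arc_image[of d u] d unfolding closed_arc_def u b by (simp add: image_Un)
qed

lemma chi_eq_0:
  assumes "\<beta> \<noteq> 0" "x \<notin> closed_arc (left_nb \<beta>) (right_nb \<beta>)"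
  shows "chi \<beta> x = 0"
  using assms by (auto simp: chi_def closed_arc_eq)

definition fwd :: "circle \<Rightarrow> circle \<Rightarrow> real" where
  "fwd a b = (THE d. 0 < d \<and> d \<le> 1 \<and> to_circle d = b - a)"

lemma fwd: "0 < fwd a b" "fwd a b \<le> 1" "to_circle (fwd a b) = b - a"
  using theI'[OF fwd_ex1[of "b - a"]] by (auto simp: fwd_def)

lemma fwd_unique: "0 < d \<Longrightarrow> d \<le> 1 \<Longrightarrow> to_circle d = b - a \<Longrightarrow> fwd a b = d"
  using fwd_ex1[of "b - a"] fwd[of a b] by blast

lemma open_arc_iff_left: "x \<in> open_arc a b \<longleftrightarrow> fwd a x < fwd a b"
proof
  assume "x \<in> open_arc a b"
  then obtain t d where td: "0 < d" "d \<le> 1" "to_circle d = b - a" "0 < t" "t < d"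
      "x = a + to_circle t"
    by (auto simp: open_arc_def)
  then have "fwd a b = d" "fwd a x = t" by (auto intro!: fwd_unique)
  with td show "fwd a x < fwd a b" by simp
next
  assume "fwd a x < fwd a b"
  moreover have "x = a + to_circle (fwd a x)" by (simp add: fwd)
  ultimately show "x \<in> open_arc a b" unfolding open_arc_def using fwd by blast
qed

lemma open_arc_iff_right: "x \<in> open_arc a b \<longleftrightarrow> fwd x b < fwd a b"
proof
  assume "x \<in> open_arc a b"
  then obtain t d where td: "0 < d" "d \<le> 1" "to_circle d = b - a" "0 < t" "t < d"
      "x = a + to_circle t"
    by (auto simp: open_arc_def)
  then have "fwd a b = d" "fwd x b = d - t" by (auto intro!: fwd_unique simp: to_circle_diff)
  with td show "fwd x b < fwd a b" by simp
next
  assume *: "fwd x b < fwd a b"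
  have "x = a + to_circle (fwd a b - fwd x b)" by (simp add: fwd to_circle_diff)
  moreover have "0 < fwd a b - fwd x b" "fwd a b - fwd x b < fwd a b"
    using * fwd[of x b] by auto
  ultimately show "x \<in> open_arc a b" unfolding open_arc_def using fwd by blast
qed

lemma zero_in_farey: "Q \<ge> 1 \<Longrightarrow> 0 \<in> farey Q"
  using height_eqI[of 0 1] by (auto simp: farey_def QZ_def to_circle_0 intro!: image_eqI[of _ _ 0])

lemma min_ex1:
  assumes "finite S" "z \<in> S" "z \<noteq> \<beta>" "inj f" "f \<beta> = (1::real)" "\<And>x. f x \<le> 1"
  shows "\<exists>!\<gamma>. \<gamma> \<in> S \<and> \<gamma> \<noteq> \<beta> \<and> (\<forall>x\<in>S. \<not> f x < f \<gamma>)"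
proof -
  have "finite (S - {\<beta>})" "S - {\<beta>} \<noteq> {}" using assms by auto
  then have "Min (f ` (S - {\<beta>})) \<in> f ` (S - {\<beta>})" by (intro Min_in) auto
  then obtain g where g0: "g \<in> S - {\<beta>}" "f g = Min (f ` (S - {\<beta>}))" by fastforce
  have g: "g \<in> S - {\<beta>}" "\<And>x. x \<in> S - {\<beta>} \<Longrightarrow> f g \<le> f x"
    using g0 \<open>finite (S - {\<beta>})\<close> by auto
  have "\<not> f x < f g" if "x \<in> S" for x
    using that g assms(5) assms(6)[of g] by (cases "x = \<beta>") (auto simp: not_less)
  then show ?thesis
  proof (intro ex1I[of _ g])
    fix h assume h: "h \<in> S \<and> h \<noteq> \<beta> \<and> (\<forall>x\<in>S. \<not> f x < f h)"
    then have "f h = f g" using g by (meson Diff_iff empty_iff insert_iff not_less order_antisym)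
    then show "h = g" using \<open>inj f\<close> by (simp add: inj_eq)
  qed (use g in auto)
qed

lemma fwd_self: "fwd a a = 1"
  by (rule fwd_unique) (auto simp: to_circle_eq_iff simp flip: to_circle_0)

lemma ends_notin_open_arc: "a \<notin> open_arc a b" "b \<notin> open_arc a b"
  using fwd(2)[of a b] by (simp_all add: open_arc_iff_left fwd_self)

lemma chi_eq_half:
  assumes "\<beta> \<noteq> 0" "x \<in> {left_nb \<beta>, right_nb \<beta>}"
  shows "chi \<beta> x = 1/2"
  using assms by (auto simp: chi_def ends_notin_open_arc)

lemma height_ge_1: "\<beta> \<in> QZ \<Longrightarrow> height \<beta> \<ge> 1"
  by (auto elim: QZ_cases)

lemma right_nb_ex1:
  assumes "\<beta> \<in> QZ" "\<beta> \<noteq> 0"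
  shows "\<exists>!\<gamma>. \<gamma> \<in> farey (height \<beta>) \<and> \<gamma> \<noteq> \<beta> \<and> open_arc \<beta> \<gamma> \<inter> farey (height \<beta>) = {}"
proof -
  have "inj (fwd \<beta>)" by (rule injI) (metis fwd(3) diff_add_cancel)
  then have "\<exists>!\<gamma>. \<gamma> \<in> farey (height \<beta>) \<and> \<gamma> \<noteq> \<beta> \<and>
      (\<forall>x\<in>farey (height \<beta>). \<not> fwd \<beta> x < fwd \<beta> \<gamma>)"
    using assms by (intro min_ex1[of _ 0] finite_farey zero_in_farey height_ge_1 fwd_self fwd) auto
  moreover have "open_arc \<beta> \<gamma> \<inter> farey (height \<beta>) = {} \<longleftrightarrow>
      (\<forall>x\<in>farey (height \<beta>). \<not> fwd \<beta> x < fwd \<beta> \<gamma>)" for \<gamma>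
    by (auto simp: disjoint_iff open_arc_iff_left)
  ultimately show ?thesis by simp
qed

lemma left_nb_ex1:
  assumes "\<beta> \<in> QZ" "\<beta> \<noteq> 0"
  shows "\<exists>!\<gamma>. \<gamma> \<in> farey (height \<beta>) \<and> \<gamma> \<noteq> \<beta> \<and> open_arc \<gamma> \<beta> \<inter> farey (height \<beta>) = {}"
proof -
  have "inj (\<lambda>x. fwd x \<beta>)" by (rule injI) (metis fwd(3) diff_diff_eq2 add_diff_cancel_left')
  then have "\<exists>!\<gamma>. \<gamma> \<in> farey (height \<beta>) \<and> \<gamma> \<noteq> \<beta> \<and>
      (\<forall>x\<in>farey (height \<beta>). \<not> fwd x \<beta> < fwd \<gamma> \<beta>)"
    using assms by (intro min_ex1[of _ 0] finite_farey zero_in_farey height_ge_1 fwd_self fwd) auto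
  moreover have "open_arc \<gamma> \<beta> \<inter> farey (height \<beta>) = {} \<longleftrightarrow>
      (\<forall>x\<in>farey (height \<beta>). \<not> fwd x \<beta> < fwd \<gamma> \<beta>)" for \<gamma>
    by (auto simp: disjoint_iff open_arc_iff_right)
  ultimately show ?thesis by simp
qed

end

theory Submission
  imports Defs
begin

text \<open>
  For a fraction \<open>a/q\<close> in lowest terms, \<open>\<chi>\<^sub>\<beta>(\<alpha>) = 1\<close> says that no fraction with
  denominator at most \<open>q\<close> lies strictly between \<open>a/q\<close> and \<open>\<alpha>\<close>.
  An intermediate convergent \<open>w = (m p\<^sub>n\<^sub>-\<^sub>1 + p\<^sub>n\<^sub>-\<^sub>2)/(m q\<^sub>n\<^sub>-\<^sub>1 + q\<^sub>n\<^sub>-\<^sub>2)\<close> and the convergent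
  \<open>p\<^sub>n\<^sub>-\<^sub>1/q\<^sub>n\<^sub>-\<^sub>1\<close> have determinant \<open>\<plusminus>1\<close> and lie on opposite sides of \<open>\<alpha>\<close>, so a fraction
  strictly between them has a denominator at least the sum of the two denominators.
  Hence \<open>w\<close> has the property. Conversely, if \<open>a/q\<close> has the property, let \<open>w\<close> be the
  last intermediate convergent on the same side of \<open>\<alpha>\<close> with denominator at most \<open>q\<close>;
  then \<open>a/q\<close> lies between \<open>w\<close> and \<open>\<alpha>\<close>, and by the same determinant bound it equals \<open>w\<close>.
\<close>

section \<open>Fractions with an empty gap to a real number\<close>

text \<open>
  The product is positive exactly when \<open>c/d\<close> lies strictly between \<open>a/q\<close> and \<open>x\<close>.
\<close>

definition closest_on_side :: "int \<Rightarrow> int \<Rightarrow> real \<Rightarrow> bool" where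
  "closest_on_side a q x \<longleftrightarrow>
    (\<forall>c d. 0 < d \<and> d \<le> q \<longrightarrow> of_int (c * q - a * d) * (of_int d * x - of_int c) \<le> 0)"

lemma between_iff_mult_pos:
  fixes x :: real
  assumes "0 < d" "0 < q"
  shows "0 < of_int (c * q - a * d) * (of_int d * x - of_int c) \<longleftrightarrow>
    (of_int a / of_int q < (of_int c / of_int d :: real) \<and> of_int c / of_int d < x) \<or>
    (x < of_int c / of_int d \<and> of_int c / of_int d < (of_int a / of_int q :: real))"
proof -
  have "(of_int a / of_int q < (of_int c / of_int d :: real)) \<longleftrightarrow> 0 < (of_int (c * q - a * d) :: real)"
    and "(of_int c / of_int d < (of_int a / of_int q :: real)) \<longleftrightarrow> (of_int (c * q - a * d) :: real) < 0"
    and "of_int c / of_int d < x \<longleftrightarrow> 0 < of_int d * x - of_int c"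
    and "x < of_int c / of_int d \<longleftrightarrow> of_int d * x - of_int c < 0"
    using assms by (simp_all add: field_simps)
  then show ?thesis by (auto simp: zero_less_mult_iff)
qed

lemma closest_on_side_iff:
  assumes "0 < q"
  shows "closest_on_side a q x \<longleftrightarrow> (\<forall>c d. 0 < d \<and> d \<le> q \<longrightarrow>
    \<not> (of_int a / of_int q < (of_int c / of_int d :: real) \<and> of_int c / of_int d < x) \<and>
    \<not> (x < of_int c / of_int d \<and> of_int c / of_int d < (of_int a / of_int q :: real)))"
  unfolding closest_on_side_def not_less[symmetric]
  using between_iff_mult_pos[OF _ assms] by meson

text \<open>Up to the orientation \<open>s\<close>, the pairs \<open>(c1, d1)\<close> and
  \<open>(c2, d2)\<close> form a basis of the integer lattice. The coordinates of
  \<open>(c, d)\<close> in it are the two positive determinants, hence at least 1.\<close>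

lemma farey_denominator_bound:
  fixes c d c1 d1 c2 d2 s :: int
  assumes "s * (c2 * d1 - c1 * d2) = 1" "0 \<le> d1" "0 \<le> d2"
    and "0 < s * (c * d1 - c1 * d)" "0 < s * (c2 * d - c * d2)"
  shows "d1 + d2 \<le> d"
proof -
  have "d = (s * (c2 * d1 - c1 * d2)) * d" using assms(1) by simp
  also have "\<dots> = d1 * (s * (c2 * d - c * d2)) + d2 * (s * (c * d1 - c1 * d))"
    by (simp add: algebra_simps)
  finally have *: "d = d1 * (s * (c2 * d - c * d2)) + d2 * (s * (c * d1 - c1 * d))" .
  have "d1 * 1 \<le> d1 * (s * (c2 * d - c * d2))" "d2 * 1 \<le> d2 * (s * (c * d1 - c1 * d))"
    using assms by (intro mult_left_mono; simp)+
  then show ?thesis using * by linarith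
qed

text \<open>The two linear forms, weighted by \<open>q\<close> and \<open>-d\<close>, add up to the
  determinant, and \<open>x\<close> cancels. This turns positions relative to \<open>x\<close> into
  the integer inequalities of \<open>farey_denominator_bound\<close>.\<close>

lemma opposite_sides_det_pos:
  fixes c d p q s :: int and x :: real
  assumes "0 < d" "0 < q" "0 < of_int s * (of_int d * x - of_int c)"
    and "of_int s * (of_int q * x - of_int p) < 0"
  shows "0 < s * (p * d - c * q)"
proof -
  have "0 < of_int q * (of_int s * (of_int d * x - of_int c))"
    and "0 < of_int d * - (of_int s * (of_int q * x - of_int p))"
    by (rule mult_pos_pos; use assms in simp)+
  then have "0 < of_int q * (of_int s * (of_int d * x - of_int c))
      + of_int d * - (of_int s * (of_int q * x - of_int p))"
    by (rule add_pos_pos)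
  also have "\<dots> = of_int (s * (p * d - c * q))" by (simp add: algebra_simps)
  finally show ?thesis by (simp only: of_int_0_less_iff)
qed

section \<open>Continued fractions of irrational numbers\<close>

lemma cf_rem_irrational: "x \<notin> \<rat> \<Longrightarrow> cf_rem x n \<notin> \<rat>"
proof (induction n)
  case (Suc n)
  show ?case
  proof
    assume "cf_rem x (Suc n) \<in> \<rat>"
    then have "1 / cf_rem x (Suc n) + of_int \<lfloor>cf_rem x n\<rfloor> \<in> \<rat>"
      by (intro Rats_add Rats_divide Rats_1 Rats_of_int)
    then show False using Suc by (simp add: frac_def)
  qed
qed simp

lemma cf_quot_less_rem: "x \<notin> \<rat> \<Longrightarrow> of_int (cf_quot x n) < cf_rem x n"
  using cf_rem_irrational[of x n] unfolding cf_quot_def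
  by (metis Rats_of_int of_int_floor_le order_less_le)

lemma cf_quot_ge_1:
  assumes "x \<notin> \<rat>" "n \<ge> 1"
  shows "1 \<le> cf_quot x n"
proof -
  obtain k where k: "n = Suc k" using assms(2) by (cases n) auto
  have "frac (cf_rem x k) \<noteq> 0"
    using cf_quot_less_rem[OF assms(1), of k] by (simp add: cf_quot_def frac_def)
  then have "0 < frac (cf_rem x k)" "frac (cf_rem x k) < 1"
    using frac_ge_0[of "cf_rem x k"] frac_lt_1 by (auto simp: order_less_le)
  then show ?thesis by (simp add: cf_quot_def k le_floor_iff)
qed

lemma cf_det: "(-1) ^ n * (cf_p x (Suc n) * cf_q x n - cf_p x n * cf_q x (Suc n)) = 1"
  by (induction n) (auto simp: algebra_simps)

text \<open>Adding a multiple of one column to the other preserves the determinant.\<close>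

lemma cf_intermediate_det:
  "(-1) ^ n * (cf_p x (Suc n) * (m * cf_q x (Suc n) + cf_q x n)
     - (m * cf_p x (Suc n) + cf_p x n) * cf_q x (Suc n)) = 1"
  using cf_det[of n x] by (simp add: algebra_simps)

text \<open>The expression of \<open>x\<close> through its complete quotient, cleared of
  denominators. By the recurrence each new linear form is \<open>- frac (cf_rem x n)\<close> times
  the previous one, and \<open>cf_rem x (Suc n)\<close> is the reciprocal of that fractional
  part.\<close>

lemma cf_rem_linear_form:
  assumes "x \<notin> \<rat>"
  shows "cf_rem x n * (of_int (cf_q x (Suc n)) * x - of_int (cf_p x (Suc n)))
    + (of_int (cf_q x n) * x - of_int (cf_p x n)) = 0"
proof (induction n)
  case (Suc n)
  let ?L = "\<lambda>n. of_int (cf_q x n) * x - of_int (cf_p x n)"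
  have f: "frac (cf_rem x n) \<noteq> 0"
    using cf_quot_less_rem[OF assms, of n] by (simp add: cf_quot_def frac_def)
  have "?L (Suc (Suc n)) = of_int (cf_quot x n) * ?L (Suc n) + ?L n"
    by (simp add: algebra_simps)
  also have "\<dots> = - frac (cf_rem x n) * ?L (Suc n)"
    using Suc unfolding frac_def cf_quot_def by (simp add: algebra_simps)
  finally show ?case using f by simp
qed simp

text \<open>Consecutive forms have negative ratio \<open>- cf_rem x n\<close>, so signs alternate:
  even indices belong to approximants below \<open>x\<close>, odd ones to those above, with index 1
  the formal fraction 1/0.\<close>

lemma cf_linear_form_sign:
  assumes "x \<notin> \<rat>" "0 < x"
  shows "0 < (-1) ^ n * (of_int (cf_q x n) * x - of_int (cf_p x n))"
proof (induction n)
  case (Suc n)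
  let ?L = "\<lambda>n. of_int (cf_q x n) * x - of_int (cf_p x n)"
  have "0 < cf_rem x n"
  proof (cases n)
    case (Suc k)
    then show ?thesis
      using cf_quot_ge_1[OF assms(1), of n] cf_quot_less_rem[OF assms(1), of n] by linarith
  qed (use assms in simp)
  have "?L n = - (cf_rem x n * ?L (Suc n))"
    using cf_rem_linear_form[OF assms(1), of n] by linarith
  then have "(-1) ^ n * ?L n = cf_rem x n * ((-1) ^ Suc n * ?L (Suc n))" by simp
  then show ?case using Suc \<open>0 < cf_rem x n\<close> by (metis zero_less_mult_pos)
qed (use assms in simp)

text \<open>The form equals \<open>-(cf_rem x n - m)\<close> times the form of index
  \<open>Suc n\<close>, and \<open>m\<close> stays below \<open>cf_rem x n\<close>. The value
  \<open>m = 0\<close> is included because \<open>closest_on_side_imp_intermediate\<close> can meet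
  it.\<close>

lemma cf_intermediate_sign:
  assumes "x \<notin> \<rat>" "0 < x" "m \<le> cf_quot x n"
  shows "0 < (-1) ^ n * (of_int (m * cf_q x (Suc n) + cf_q x n) * x
    - of_int (m * cf_p x (Suc n) + cf_p x n))"
proof -
  let ?L = "\<lambda>n. of_int (cf_q x n) * x - of_int (cf_p x n)"
  have L: "?L n = - (cf_rem x n * ?L (Suc n))"
    using cf_rem_linear_form[OF assms(1), of n] by linarith
  have "of_int (m * cf_q x (Suc n) + cf_q x n) * x - of_int (m * cf_p x (Suc n) + cf_p x n)
      = of_int m * ?L (Suc n) + ?L n"
    by (simp add: algebra_simps)
  also have "\<dots> = - ((cf_rem x n - of_int m) * ?L (Suc n))"
    unfolding L by (simp only: left_diff_distrib)
  finally have "(-1) ^ n * (of_int (m * cf_q x (Suc n) + cf_q x n) * x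
    - of_int (m * cf_p x (Suc n) + cf_p x n)) = (cf_rem x n - of_int m) * ((-1) ^ Suc n * ?L (Suc n))"
    by simp
  moreover have "0 < cf_rem x n - of_int m"
    using cf_quot_less_rem[OF assms(1), of n] assms(3) by linarith
  ultimately show ?thesis using cf_linear_form_sign[OF assms(1,2), of "Suc n"]
    by (metis mult_pos_pos)
qed

section \<open>Positivity and growth of the denominators\<close>

lemma cf_unit_interval_init:
  assumes "0 < x" "x < 1"
  shows "cf_quot x 0 = 0" "cf_p x (Suc (Suc 0)) = 0" "cf_q x (Suc (Suc 0)) = 1"
proof -
  show "cf_quot x 0 = 0" using assms by (simp add: cf_quot_def floor_eq_iff)
  then show "cf_p x (Suc (Suc 0)) = 0" "cf_q x (Suc (Suc 0)) = 1" by simp_all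
qed

text \<open>Two consecutive bounds are carried through the induction; the first cannot be strict
  because \<open>cf_q x (Suc 0) = 0\<close>.\<close>

lemma cf_q_pos:
  assumes "x \<notin> \<rat>" "0 < x" "x < 1"
  shows "0 \<le> cf_q x (Suc n) \<and> 0 < cf_q x (Suc (Suc n))"
proof (induction n)
  case 0
  then show ?case using cf_unit_interval_init[OF assms(2,3)] by simp
next
  case (Suc n)
  then show ?case using cf_quot_ge_1[OF assms(1), of "Suc n"]
    by (simp only: cf_q.simps(3)[of _ "Suc n"]) (auto intro: add_pos_nonneg)
qed

lemma cf_q_step2:
  assumes "x \<notin> \<rat>" "0 < x" "x < 1" "n \<ge> 1"
  shows "cf_q x n + 1 \<le> cf_q x (Suc (Suc n))"
proof -
  have "0 < cf_q x (Suc n)" using cf_q_pos[OF assms(1-3)] assms(4) by (cases n) auto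
  then have "1 * 1 \<le> cf_quot x n * cf_q x (Suc n)"
    using cf_quot_ge_1[OF assms(1,4)] by (intro mult_mono) auto
  then show ?thesis by simp
qed

text \<open>Steps of two keep the parity of the index, hence the side of \<open>x\<close>. Along
  them the denominators grow by at least 1, so they eventually pass \<open>q\<close>.\<close>

lemma cf_q_bracket:
  assumes "x \<notin> \<rat>" "0 < x" "x < 1" "i \<ge> 1" "cf_q x i \<le> q"
  obtains j where "cf_q x (2 * j + i) \<le> q" "q < cf_q x (Suc (Suc (2 * j + i)))"
proof -
  have grow: "cf_q x i + int j \<le> cf_q x (2 * j + i)" for j
  proof (induction j)
    case (Suc j)
    then show ?case using cf_q_step2[OF assms(1-3), of "2 * j + i"] assms(4) by simp
  qed simp
  define P where "P j \<longleftrightarrow> q < cf_q x (2 * j + i)" for j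
  have "P (nat (q - cf_q x i + 1))"
    using grow[of "nat (q - cf_q x i + 1)"] assms(5) by (simp add: P_def)
  moreover have "\<not> P 0" using assms(5) by (simp add: P_def)
  ultimately obtain j where "\<not> P j" "P (Suc j)" by (metis exists_least_lemma)
  then show ?thesis by (intro that[of j]) (auto simp: P_def)
qed

section \<open>Intermediate convergents\<close>

lemma intermediate_denominator_pos:
  assumes "x \<notin> \<rat>" "0 < x" "x < 1" "n \<ge> 1" "1 \<le> m"
  shows "0 < cf_q x (Suc n)" "0 < m * cf_q x (Suc n) + cf_q x n"
proof -
  obtain k where k: "n = Suc k" using assms(4) by (cases n) auto
  show "0 < cf_q x (Suc n)" using cf_q_pos[OF assms(1-3), of k] k by simp
  then have "0 < m * cf_q x (Suc n)" using assms(5) by simp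
  then show "0 < m * cf_q x (Suc n) + cf_q x n"
    using cf_q_pos[OF assms(1-3), of k] k by simp
qed

text \<open>A fraction in the gap would also lie between the intermediate convergent and the
  convergent of index \<open>Suc n\<close> beyond \<open>x\<close>, so its denominator would be at
  least the sum of theirs.\<close>

lemma intermediate_closest_on_side:
  assumes "x \<notin> \<rat>" "0 < x" "x < 1" "n \<ge> 1" "1 \<le> m" "m \<le> cf_quot x n"
  shows "closest_on_side (m * cf_p x (Suc n) + cf_p x n) (m * cf_q x (Suc n) + cf_q x n) x"
    (is "closest_on_side ?c ?d x")
  unfolding closest_on_side_def
proof (intro allI impI, rule ccontr)
  fix c d :: int
  assume d: "0 < d \<and> d \<le> ?d" and "\<not> of_int (c * ?d - ?c * d) * (of_int d * x - of_int c) \<le> 0"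
  then have pos: "0 < of_int (c * ?d - ?c * d) * (of_int d * x - of_int c)" by simp
  \<comment> \<open>The orientation: 1 if the intermediate convergent lies below \<open>x\<close>,
    -1 if above.\<close>
  define s :: int where "s = (-1) ^ n"
  have s: "of_int s = (-1 :: real) ^ n" "s = 1 \<or> s = -1"
    by (auto simp: s_def minus_one_power_iff)
  note den = intermediate_denominator_pos[OF assms(1-5)]
  have far: "of_int s * (of_int (cf_q x (Suc n)) * x - of_int (cf_p x (Suc n))) < 0"
    using cf_linear_form_sign[OF assms(1,2), of "Suc n"] by (simp add: s)
  have near: "0 < of_int s * (of_int ?d * x - of_int ?c)"
    using cf_intermediate_sign[OF assms(1,2,6)] by (simp only: s)
  \<comment> \<open>Both factors have the same sign. If both were negative after orientation,
    \<open>c/d\<close> would lie beyond \<open>x\<close>, which makes the determinant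
    positive.\<close>
  have sides: "0 < s * (c * ?d - ?c * d) \<and> 0 < of_int s * (of_int d * x - of_int c)"
  proof (rule ccontr)
    assume "\<not> ?thesis"
    then have *: "s * (c * ?d - ?c * d) < 0" "of_int s * (of_int d * x - of_int c) < 0"
      using s(2) pos by (auto simp: zero_less_mult_iff simp del: of_int_add of_int_mult of_int_diff)
    have "0 < s * (c * ?d - ?c * d)"
      by (rule opposite_sides_det_pos[OF den(2) _ near *(2)]) (use d in simp)
    then show False using *(1) by simp
  qed
  have "?d + cf_q x (Suc n) \<le> d"
  proof (rule farey_denominator_bound[of s])
    show "s * (cf_p x (Suc n) * ?d - ?c * cf_q x (Suc n)) = 1"
      unfolding s_def by (rule cf_intermediate_det)
    show "0 < s * (cf_p x (Suc n) * d - c * cf_q x (Suc n))"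
      by (rule opposite_sides_det_pos[OF _ den(1) _ far]) (use d sides in auto)
  qed (use den sides in auto)
  then show False using d den by simp
qed

lemma coprime_intermediate:
  "coprime (m * cf_p x (Suc n) + cf_p x n) (m * cf_q x (Suc n) + cf_q x n)"
proof (rule coprimeI)
  fix k assume k: "k dvd m * cf_p x (Suc n) + cf_p x n" "k dvd m * cf_q x (Suc n) + cf_q x n"
  then have "k dvd (-1) ^ n * (cf_p x (Suc n) * (m * cf_q x (Suc n) + cf_q x n)
     - (m * cf_p x (Suc n) + cf_p x n) * cf_q x (Suc n))"
    by (intro dvd_mult dvd_diff dvd_mult2) auto
  then show "is_unit k" unfolding cf_intermediate_det .
qed

text \<open>With \<open>c/d\<close> the candidate on the side of \<open>a/q\<close>, a fraction
  \<open>a/q\<close> nearer to \<open>x\<close> would need denominator at least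
  \<open>d + cf_q x (Suc n) > q\<close>, while a farther one would have \<open>c/d\<close> in its
  gap. So the two are equal.\<close>

lemma closest_on_side_imp_intermediate:
  assumes x: "x \<notin> \<rat>" "0 < x" "x < 1" and aq: "0 < a" "a < q" and cl: "closest_on_side a q x"
  obtains n m where "n \<ge> 1" "1 \<le> m" "m \<le> cf_quot x n"
    "of_int a / of_int q = (of_int (m * cf_p x (Suc n) + cf_p x n)
       / of_int (m * cf_q x (Suc n) + cf_q x n) :: real)"
proof -
  have q: "0 < q" using aq by simp
  have "of_int q * x - of_int a \<noteq> 0"
  proof
    assume "of_int q * x - of_int a = 0"
    then have "x = of_int a / of_int q" using q by (simp add: field_simps)
    then show False using x(1) by simp
  qed
  \<comment> \<open>The parity of \<open>i\<close> encodes the side of \<open>a/q\<close>. The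
    choices 1 and 2 have starting denominators 0 and 1, both at most \<open>q\<close>.\<close>
  then have "\<exists>i::nat. (i = 1 \<or> i = 2) \<and> 0 < (-1) ^ i * (of_int q * x - of_int a)"
    by (cases "of_int q * x < of_int a") (force intro: exI[of _ 1], force intro: exI[of _ 2])
  then obtain i :: nat where i: "i = 1 \<or> i = 2" "0 < (-1) ^ i * (of_int q * x - of_int a)"
    by blast
  have "cf_q x i \<le> q" using i(1) q cf_unit_interval_init[OF x(2,3)]
    by (auto simp: numeral_2_eq_2 simp del: cf_q.simps(3))
  then obtain j where j: "cf_q x (2 * j + i) \<le> q" "q < cf_q x (Suc (Suc (2 * j + i)))"
    by (rule cf_q_bracket[OF x, rotated]) (use i(1) in auto)
  define n where "n = 2 * j + i"
  define s :: int where "s = (-1) ^ n"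
  have s: "of_int s = (-1 :: real) ^ n" "s = 1 \<or> s = -1" by (auto simp: s_def minus_one_power_iff)
  have si: "of_int s = (-1 :: real) ^ i" by (simp add: s n_def power_add)
  have n: "n \<ge> 1" using i(1) by (auto simp: n_def)
  obtain k where k: "n = Suc k" using n by (cases n) auto
  have q1: "0 < cf_q x (Suc n)" and q0: "0 \<le> cf_q x n" using cf_q_pos[OF x, of k] k by auto
  \<comment> \<open>The largest multiplier for which the denominator \<open>d\<close> is still at
    most \<open>q\<close>.\<close>
  define m where "m = (q - cf_q x n) div cf_q x (Suc n)"
  define c where "c = m * cf_p x (Suc n) + cf_p x n"
  define d where "d = m * cf_q x (Suc n) + cf_q x n"
  have m0: "0 \<le> m" using j(1) q1 by (simp add: m_def n_def pos_imp_zdiv_nonneg_iff)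
  have dm: "d = q - (q - cf_q x n) mod cf_q x (Suc n)"
    using div_mult_mod_eq[of "q - cf_q x n" "cf_q x (Suc n)"] by (simp add: d_def m_def)
  have dq: "d \<le> q" "q < d + cf_q x (Suc n)"
    using pos_mod_sign[OF q1, of "q - cf_q x n"] pos_mod_bound[OF q1, of "q - cf_q x n"] dm
    by linarith+
  have "m * cf_q x (Suc n) < cf_quot x n * cf_q x (Suc n)"
    using dq(1) j(2) by (simp add: d_def n_def[symmetric])
  then have mq: "m < cf_quot x n" using q1 by simp
  \<comment> \<open>Only the formal fraction 1/0, at \<open>n = 1\<close> and \<open>m = 0\<close>,
    could fail; there \<open>cf_q x (Suc n) = 1\<close>, and the maximality of \<open>m\<close>
    would give \<open>q < 1\<close>.\<close>
  have d0: "0 < d"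
  proof (rule ccontr)
    assume "\<not> 0 < d"
    then have "cf_q x n \<le> 0" "m * cf_q x (Suc n) \<le> 0"
      using m0 q1 q0 mult_nonneg_nonneg[of m "cf_q x (Suc n)"] unfolding d_def by linarith+
    then have "k = 0" using cf_q_pos[OF x, of "k - 1"] k by (cases k) auto
    then have "cf_q x (Suc n) = 1" using k cf_unit_interval_init(3)[OF x(2,3)] by simp
    then show False using dq(2) \<open>\<not> 0 < d\<close> q by linarith
  qed
  have near: "0 < of_int s * (of_int d * x - of_int c)"
    using cf_intermediate_sign[OF x(1,2), of m n] mq by (simp only: s d_def c_def)
  have far: "of_int s * (of_int (cf_q x (Suc n)) * x - of_int (cf_p x (Suc n))) < 0"
    using cf_linear_form_sign[OF x(1,2), of "Suc n"] by (simp add: s)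
  have aside: "0 < of_int s * (of_int q * x - of_int a)" using i(2) by (simp add: si)
  have "\<not> 0 < s * (a * d - c * q)"
  proof
    assume *: "0 < s * (a * d - c * q)"
    have "d + cf_q x (Suc n) \<le> q"
    proof (rule farey_denominator_bound[of s])
      show "s * (cf_p x (Suc n) * d - c * cf_q x (Suc n)) = 1"
        unfolding s_def c_def d_def by (rule cf_intermediate_det)
      show "0 < s * (cf_p x (Suc n) * q - a * cf_q x (Suc n))"
        by (rule opposite_sides_det_pos[OF q q1 aside far])
    qed (use * d0 q1 in auto)
    then show False using dq(2) by simp
  qed
  moreover have "\<not> s * (a * d - c * q) < 0"
  proof
    assume *: "s * (a * d - c * q) < 0"
    have "of_int (c * q - a * d) * (of_int d * x - of_int c) \<le> 0"
      using cl d0 dq(1) unfolding closest_on_side_def by blast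
    then show False using * near s(2)
      by (auto simp: mult_le_0_iff simp del: of_int_add of_int_mult of_int_diff)
  qed
  ultimately have eq: "a * d = c * q" using s(2) by auto
  have "(of_int a * of_int d :: real) = of_int c * of_int q" by (simp flip: of_int_mult add: eq)
  then have frac_eq: "of_int a / of_int q = (of_int c / of_int d :: real)"
    using d0 q by (simp add: field_simps)
  show ?thesis
  proof (cases "m \<ge> 1")
    case True
    show ?thesis by (rule that[OF n True]) (use mq frac_eq in \<open>auto simp: c_def d_def\<close>)
  next
    \<comment> \<open>For \<open>m = 0\<close> the candidate is the convergent of index
      \<open>n\<close>, which is the last member of the family two indices earlier. Family 0 is
      excluded since it would give the fraction 0/1, whereas \<open>a > 0\<close>.\<close>
    case False
    then have m: "m = 0" using m0 by simp
    have "k \<noteq> 0" using d0 by (intro notI) (simp add: d_def m k)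
    then obtain l where l: "n = Suc (Suc l)" using k by (cases k) auto
    have "l \<noteq> 0"
    proof
      assume "l = 0"
      then have "c = 0" using cf_unit_interval_init(2)[OF x(2,3)] l by (simp add: c_def m)
      then show False using eq d0 aq by simp
    qed
    then have l1: "l \<ge> 1" by simp
    show ?thesis
      by (rule that[OF l1 cf_quot_ge_1[OF x(1) l1] order_refl])
        (use frac_eq in \<open>simp add: c_def d_def m l\<close>)
  qed
qed

section \<open>The indicator of a Farey arc\<close>

text \<open>\<open>closest_on_side\<close> ranges over unreduced fractions too; reducing one
  replaces its denominator by a divisor.\<close>

lemma fraction_in_farey:
  assumes "0 < d" "d \<le> int Q"
  shows "to_circle (of_int c / of_int d) \<in> farey Q"
proof -
  have "(of_int c / of_int d :: real) \<in> \<rat>" by simp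
  then obtain a b :: int where ab: "b > 0" "coprime a b" "of_int c / of_int d = (of_int a / of_int b :: real)"
    by (rule Rats_cases')
  have "(of_int (c * b) :: real) = of_int (a * d)" using ab(1,3) assms(1) by (simp add: field_simps)
  then have "c * b = a * d" by (simp only: of_int_eq_iff)
  then have "b dvd a * d" by (metis dvd_triv_right)
  then have "b dvd d" using ab(2) by (simp add: coprime_commute coprime_dvd_mult_right_iff)
  then have "b \<le> d" using assms(1) by (simp add: zdvd_imp_le)
  moreover have "height (to_circle (of_int c / of_int d)) = nat b"
    using height_eqI[of a "nat b"] ab by simp
  ultimately show ?thesis using assms by (auto simp: farey_def QZ_def)
qed

lemma farey_lift_fraction:
  assumes "to_circle u \<in> farey Q"
  obtains c d where "0 < d" "d \<le> int Q" "u = of_int c / of_int d"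
proof -
  obtain a q where aq: "q \<ge> 1" "to_circle u = to_circle (of_int a / of_nat q)" "q \<le> Q"
    using assms by (auto simp: farey_def elim: QZ_cases)
  then obtain k :: int where "u - of_int a / of_nat q = of_int k"
    by (auto simp: to_circle_eq_iff elim: Ints_cases)
  then have "u = of_int (a + k * int q) / of_int (int q)" using aq(1) by (simp add: field_simps)
  then show ?thesis using that[of "int q" "a + k * int q"] aq by simp
qed

text \<open>Since \<open>x\<close> is strictly inside the unit interval, the integer
  \<open>x - y\<close> has absolute value below 1 even if \<open>y\<close> is an endpoint.\<close>

lemma to_circle_inj_unit:
  assumes "to_circle x = to_circle y" "0 < x" "x < 1" "0 \<le> y" "y \<le> 1"
  shows "x = y"
proof -
  obtain k :: int where k: "x - y = of_int k"
    using assms(1) by (auto simp: to_circle_eq_iff elim: Ints_cases)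
  then have "k = 0" using assms by linarith
  then show ?thesis using k by simp
qed

lemma to_circle_1: "to_circle 1 = 0"
  by (simp add: to_circle_eq_iff flip: to_circle_0)

text \<open>The arc lifts to a real interval from \<open>u\<close> to \<open>v\<close> around
  \<open>b\<close>, inside the closed unit interval, so order on the circle becomes order on the
  reals.\<close>

lemma chi_eq_1_iff:
  assumes x: "x \<notin> \<rat>" "0 < x" "x < 1" and aq: "0 < a" "a < q" "coprime a q"
  shows "chi (to_circle (of_int a / of_int q)) (to_circle x) = 1 \<longleftrightarrow> closest_on_side a q x"
proof -
  define b where "b = (of_int a / of_int q :: real)"
  define \<beta> where "\<beta> = to_circle b"
  have b: "0 < b" "b < 1" using aq by (auto simp: b_def)
  have \<beta>0: "\<beta> \<noteq> 0"
    using to_circle_inj_unit[of b 0] b by (auto simp: \<beta>_def to_circle_0)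
  have \<beta>Q: "\<beta> \<in> QZ" by (auto simp: \<beta>_def b_def QZ_def)
  have h: "height \<beta> = nat q" using height_eqI[of a "nat q"] aq by (simp add: \<beta>_def b_def)
  have L: "left_nb \<beta> \<in> farey (nat q)" "open_arc (left_nb \<beta>) \<beta> \<inter> farey (nat q) = {}"
    using theI'[OF left_nb_ex1[OF \<beta>Q \<beta>0]] by (auto simp: left_nb_def h)
  have R: "right_nb \<beta> \<in> farey (nat q)" "open_arc \<beta> (right_nb \<beta>) \<inter> farey (nat q) = {}"
    using theI'[OF right_nb_ex1[OF \<beta>Q \<beta>0]] by (auto simp: right_nb_def h)
  define u where "u = b - fwd (left_nb \<beta>) \<beta>"
  define v where "v = b + fwd \<beta> (right_nb \<beta>)"
  have u: "to_circle u = left_nb \<beta>" "u < b" "b \<le> u + 1"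
    using fwd[of "left_nb \<beta>" \<beta>] by (auto simp: u_def to_circle_diff \<beta>_def)
  have v: "to_circle v = right_nb \<beta>" "b < v" "v \<le> b + 1"
    using fwd[of \<beta> "right_nb \<beta>"] by (auto simp: v_def to_circle_add \<beta>_def)
  have Larc: "open_arc (left_nb \<beta>) \<beta> = to_circle ` {u<..<b}"
    using open_arc_image[of "b - u" u] u by (simp add: \<beta>_def)
  have Rarc: "open_arc \<beta> (right_nb \<beta>) = to_circle ` {b<..<v}"
    using open_arc_image[of "v - b" b] v by (simp add: \<beta>_def)
  have zero: "0 \<in> farey (nat q)" using aq by (intro zero_in_farey) auto
  \<comment> \<open>The point 0 belongs to every Farey set of positive order, so neither half of the
    arc can pass over it.\<close>
  have u0: "0 \<le> u"
  proof (rule ccontr)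
    assume "\<not> 0 \<le> u"
    then have "to_circle 0 \<in> to_circle ` {u<..<b}" using b by (intro imageI) auto
    then show False using L(2) zero by (auto simp: Larc to_circle_0)
  qed
  have v1: "v \<le> 1"
  proof (rule ccontr)
    assume "\<not> v \<le> 1"
    then have "to_circle 1 \<in> to_circle ` {b<..<v}" using b by (intro imageI) auto
    then show False using R(2) zero by (auto simp: Rarc to_circle_1)
  qed
  have arc: "open_arc (left_nb \<beta>) (right_nb \<beta>) = to_circle ` {u<..<v}"
    using open_arc_image[of "v - u" u] u v u0 v1 by simp
  have mem: "to_circle x \<in> open_arc (left_nb \<beta>) (right_nb \<beta>) \<longleftrightarrow> u < x \<and> x < v"
  proof
    assume "to_circle x \<in> open_arc (left_nb \<beta>) (right_nb \<beta>)"
    then obtain y where "to_circle x = to_circle y" "u < y" "y < v" by (auto simp: arc)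
    then show "u < x \<and> x < v" using to_circle_inj_unit[of x y] x u0 v1 by auto
  qed (auto simp: arc)
  have "chi \<beta> (to_circle x) = 1 \<longleftrightarrow> u < x \<and> x < v"
    using \<beta>0 by (auto simp: chi_def mem)
  also have "\<dots> \<longleftrightarrow> closest_on_side a q x"
  proof
    assume ux: "u < x \<and> x < v"
    have no: "r \<notin> {u<..<b}" "r \<notin> {b<..<v}" if "to_circle r \<in> farey (nat q)" for r
      using L(2) R(2) that unfolding Larc Rarc by blast+
    show "closest_on_side a q x"
      unfolding closest_on_side_iff[of q a x, OF order_less_trans[OF aq(1,2)]] b_def[symmetric]
    proof (intro allI impI)
      fix c d :: int assume "0 < d \<and> d \<le> q"
      then have "to_circle (of_int c / of_int d) \<in> farey (nat q)"
        by (intro fraction_in_farey) auto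
      from no[OF this] ux
      show "\<not> (b < of_int c / of_int d \<and> of_int c / of_int d < x) \<and>
          \<not> (x < of_int c / of_int d \<and> of_int c / of_int d < b)"
        by auto
    qed
  next
    assume "closest_on_side a q x"
    then have cl: "\<not> (b < of_int c / of_int d \<and> of_int c / of_int d < x) \<and>
          \<not> (x < of_int c / of_int d \<and> of_int c / of_int d < b)" if "0 < d" "d \<le> q" for c d
      using that aq unfolding b_def by (subst (asm) closest_on_side_iff) auto
    obtain c d where cd: "0 < d" "d \<le> int (nat q)" "u = of_int c / of_int d"
      using farey_lift_fraction[of u "nat q", unfolded u(1), OF L(1)] .
    obtain c' d' where cd': "0 < d'" "d' \<le> int (nat q)" "v = of_int c' / of_int d'"
      using farey_lift_fraction[of v "nat q", unfolded v(1), OF R(1)] .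
    \<comment> \<open>If \<open>x\<close> were outside the interval, irrationality would put it
      strictly beyond an endpoint, and that endpoint would be a fraction in the gap.\<close>
    have "x \<noteq> u" "x \<noteq> v" using x(1) cd cd' by auto
    then show "u < x \<and> x < v"
      using cl[of d c] cl[of d' c'] cd cd' u v aq by auto
  qed
  finally show ?thesis by (simp add: \<beta>_def b_def)
qed

section \<open>Matching the indicators with the sets \<open>E n \<alpha>\<close>, and
  counting\<close>

lemma E_subset_QZ: "E n \<alpha> \<subseteq> QZ"
  by (auto simp: E_def QZ_def Let_def simp del: of_int_add of_int_mult)

lemma QZ_nonzero_cases:
  assumes "\<beta> \<in> QZ" "\<beta> \<noteq> 0"
  obtains a q where "0 < a" "a < q" "coprime a q" "\<beta> = to_circle (of_int a / of_int q)"
proof -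
  obtain a q where aq: "q \<ge> 1" "coprime a (int q)" "\<beta> = to_circle (of_int a / of_nat q)"
    using assms(1) by (auto elim: QZ_cases)
  have "(of_int a :: real) = of_int (int q * (a div int q) + a mod int q)" by simp
  then have "of_int a / of_nat q - of_int (a mod int q) / of_nat q = (of_int (a div int q) :: real)"
    using aq(1) by (simp only: of_int_add of_int_mult) (simp add: field_simps)
  then have \<beta>: "\<beta> = to_circle (of_int (a mod int q) / of_int (int q))"
    unfolding aq(3) to_circle_eq_iff by simp
  have "a mod int q \<noteq> 0" using assms(2) \<beta> by (auto simp: to_circle_0)
  then have "0 < a mod int q" "a mod int q < int q"
    using pos_mod_sign[of "int q" a] pos_mod_bound[of "int q" a] aq(1) by linarith+
  moreover have "coprime (a mod int q) (int q)" using aq(1,2) by simp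
  ultimately show ?thesis using that \<beta> by blast
qed

lemma chi_eq_1_iff_mem_E:
  assumes "\<alpha> \<notin> QZ" "\<beta> \<in> QZ"
  shows "chi \<beta> \<alpha> = 1 \<longleftrightarrow> (\<exists>n\<ge>1. \<beta> \<in> E n \<alpha>)"
proof -
  define x where "x = unit_rep \<alpha>"
  have x': "0 \<le> x" "x < 1" "to_circle x = \<alpha>"
    using theI'[OF unit_rep_ex1[of \<alpha>]] by (auto simp: x_def unit_rep_def)
  have irr: "x \<notin> \<rat>" using assms(1) x'(3) by (auto simp: QZ_def)
  then have "x \<noteq> 0" by auto
  then have x: "x \<notin> \<rat>" "0 < x" "x < 1" using irr x' by auto
  have E: "E n \<alpha> = {to_circle (of_int (m * cf_p x (Suc n) + cf_p x n)
      / of_int (m * cf_q x (Suc n) + cf_q x n)) | m. 1 \<le> m \<and> m \<le> cf_quot x n}" for n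
    by (simp add: E_def x_def Let_def)
  show ?thesis
  proof (cases "\<beta> = 0")
    case True
    \<comment> \<open>On the circle 0 arises as 1/1, the member of \<open>E 1 \<alpha>\<close> with
      \<open>m = 1\<close>.\<close>
    have "0 = to_circle (of_int (1 * cf_p x (Suc 1) + cf_p x 1)
      / of_int (1 * cf_q x (Suc 1) + cf_q x 1))"
      using cf_unit_interval_init[OF x(2,3)] by (simp add: to_circle_1)
    then have "\<beta> \<in> E 1 \<alpha>" unfolding E True
      using cf_quot_ge_1[OF x(1), of 1] by (intro CollectI exI[of _ 1]) auto
    then show ?thesis using True by (auto simp: chi_def)
  next
    case False
    show ?thesis
    proof
      assume chi: "chi \<beta> \<alpha> = 1"
      obtain a q where aq: "0 < a" "a < q" "coprime a q" "\<beta> = to_circle (of_int a / of_int q)"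
        using QZ_nonzero_cases[OF assms(2) False] .
      have "closest_on_side a q x" using chi chi_eq_1_iff[OF x aq(1-3)] aq(4) x'(3) by simp
      then obtain n m where nm: "n \<ge> 1" "1 \<le> m" "m \<le> cf_quot x n"
        "of_int a / of_int q = (of_int (m * cf_p x (Suc n) + cf_p x n)
           / of_int (m * cf_q x (Suc n) + cf_q x n) :: real)"
        by (rule closest_on_side_imp_intermediate[OF x aq(1,2)])
      then have "\<beta> \<in> E n \<alpha>" unfolding E aq(4) nm(4) by blast
      then show "\<exists>n\<ge>1. \<beta> \<in> E n \<alpha>" using nm(1) by blast
    next
      assume "\<exists>n\<ge>1. \<beta> \<in> E n \<alpha>"
      then obtain n m where n: "n \<ge> 1" and m: "1 \<le> m" "m \<le> cf_quot x n"
        and \<beta>: "\<beta> = to_circle (of_int (m * cf_p x (Suc n) + cf_p x n)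
           / of_int (m * cf_q x (Suc n) + cf_q x n))"
        unfolding E by blast
      define c where "c = m * cf_p x (Suc n) + cf_p x n"
      define d where "d = m * cf_q x (Suc n) + cf_q x n"
      have \<beta>': "\<beta> = to_circle (of_int c / of_int d)" by (simp only: \<beta> c_def d_def)
      have cl: "closest_on_side c d x"
        unfolding c_def d_def by (rule intermediate_closest_on_side[OF x n m])
      have d: "0 < d" unfolding d_def by (rule intermediate_denominator_pos[OF x n m(1)])
      have cop: "coprime c d" unfolding c_def d_def by (rule coprime_intermediate)
      \<comment> \<open>Testing against the integers 0 and 1 confines \<open>c/d\<close> to the unit
        interval, as \<open>chi_eq_1_iff\<close> requires.\<close>
      have between: "\<not> (of_int c / of_int d < (of_int k :: real) \<and> of_int k < x) \<and>
          \<not> (x < of_int k \<and> of_int k < (of_int c / of_int d :: real))" for k :: int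
        using cl[unfolded closest_on_side_iff[OF d], rule_format, of 1 k] d by simp
      have "c \<noteq> 0" using False \<beta>' by (auto simp: to_circle_0)
      moreover have "c \<noteq> d" using False \<beta>' d by (auto simp: to_circle_1)
      moreover have "0 \<le> c" using between[of 0] x d by (simp add: divide_less_0_iff)
      moreover have "c \<le> d" using between[of 1] x d by simp
      ultimately have "0 < c" "c < d" by auto
      then show "chi \<beta> \<alpha> = 1"
        using chi_eq_1_iff[OF x _ _ cop] cl \<beta>' x'(3) by simp
    qed
  qed
qed

text \<open>The value 1/2 occurs only at the neighbours, which are rational.\<close>

lemma chi_irrational_01:
  assumes "\<alpha> \<notin> QZ" "\<beta> \<in> QZ"
  shows "chi \<beta> \<alpha> = 0 \<or> chi \<beta> \<alpha> = 1"
proof (cases "\<beta> = 0")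
  case False
  have "left_nb \<beta> \<in> QZ" "right_nb \<beta> \<in> QZ"
    using theI'[OF left_nb_ex1[OF assms(2) False]] theI'[OF right_nb_ex1[OF assms(2) False]]
    by (auto simp: left_nb_def right_nb_def farey_def)
  then show ?thesis using assms(1) by (auto simp: chi_def)
qed (simp add: chi_def)

theorem theorem5:
  fixes \<alpha> :: circle
  assumes irrational: "\<alpha> \<notin> QZ"
  shows "(\<forall>\<beta>\<in>QZ. chi \<beta> \<alpha> = 1 \<longleftrightarrow> (\<exists>n\<ge>1. \<beta> \<in> E n \<alpha>)) \<and>
    (\<forall>Q\<ge>1.
      (\<Sum>\<beta> | \<beta> \<in> QZ \<and> height \<beta> \<le> Q. chi \<beta> \<alpha>) = (\<Sum>q=1..Q. X q \<alpha>) \<and>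
      (\<Sum>q=1..Q. X q \<alpha>) = real (card {\<beta> \<in> (\<Union>n\<in>{1..}. E n \<alpha>). height \<beta> \<le> Q}))"
proof (intro conjI ballI allI impI)
  fix \<beta> assume "\<beta> \<in> QZ"
  then show "chi \<beta> \<alpha> = 1 \<longleftrightarrow> (\<exists>n\<ge>1. \<beta> \<in> E n \<alpha>)"
    by (rule chi_eq_1_iff_mem_E[OF irrational])
next
  fix Q :: nat
  let ?F = "{\<beta>. \<beta> \<in> QZ \<and> height \<beta> \<le> Q}" and ?U = "{\<beta> \<in> (\<Union>n\<in>{1..}. E n \<alpha>). height \<beta> \<le> Q}"
  have fin: "finite ?F" using finite_farey[of Q] by (simp add: farey_def)
  have "(\<Sum>q=1..Q. X q \<alpha>) = (\<Sum>q=1..Q. \<Sum>\<beta> | \<beta> \<in> ?F \<and> height \<beta> = q. chi \<beta> \<alpha>)"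
    unfolding X_def by (intro sum.cong) auto
  \<comment> \<open>Heights are at least 1, so the classes from 1 to \<open>Q\<close> exhaust the
    Farey set.\<close>
  also have "\<dots> = (\<Sum>\<beta>\<in>?F. chi \<beta> \<alpha>)"
    by (intro sum.group fin) (auto dest: height_ge_1)
  finally show eq: "(\<Sum>\<beta>\<in>?F. chi \<beta> \<alpha>) = (\<Sum>q=1..Q. X q \<alpha>)" ..
  have "chi \<beta> \<alpha> = (if \<beta> \<in> ?U then 1 else 0)" if "\<beta> \<in> ?F" for \<beta>
    using that chi_irrational_01[OF irrational, of \<beta>] chi_eq_1_iff_mem_E[OF irrational, of \<beta>]
    by auto
  then have "(\<Sum>\<beta>\<in>?F. chi \<beta> \<alpha>) = (\<Sum>\<beta>\<in>?F. if \<beta> \<in> ?U then 1 else 0)"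
    by (intro sum.cong) auto
  also have "\<dots> = real (card (?F \<inter> ?U))" using fin by (simp only: sum.If_cases Collect_mem_eq) simp
  also have "?F \<inter> ?U = ?U" using E_subset_QZ by blast
  finally show "(\<Sum>q=1..Q. X q \<alpha>) = real (card ?U)" using eq by simp
qed

end
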